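(* Let $r\geq 2$ and $k\geq 2$ be integers, let $d=rk$, and let $f:\overline{\mathbb{C}}\to\overline{\mathbb{C}}$ be a rational map of degree $d$ with exactly $3$ branching points, whose branching datum is $$\{\mu_1=[\alpha_1,\ldots,\alpha_A],\ \mu_2=[rx_1,\ldots,rx_B],\ \mu_3=[ry_1,\ldots,ry_C]\},$$ where the $\alpha_i$, $x_i$, $y_i$ are positive integers. If $A=2$, then $r=2$ and $\mu_1=[k,k]$.
   Context: $\overline{\mathbb{C}}=\mathbb{C}\cup\{\infty\}$ is the Riemann sphere. Square brackets denote unordered lists with repetitions (multisets). For a non-constant rational map $h:\overline{\mathbb{C}}\to\overline{\mathbb{C}}$ of degree $d$ and $x\in\overline{\mathbb{C}}$, let $\mu(x)$ be the partition of $d$ formed by the local degrees (multiplicities) of $h$ at the points of $h^{-1}(x)$. The branching points of $h$ are the points $x$ of the target for which $\mu(x)$ is not the trivial partition $[1,\ldots,1]$, and the branching datum of $h$ is the collection (with repetitions) of the partitions $\mu(x)$ over all branching points $x$. *)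

theory Defs
  imports "HOL-Complex_Analysis.Complex_Analysis" "HOL-Library.Multiset"
begin

text \<open>The Riemann sphere, with \<^term>\<open>None\<close> as the point at infinity (the same encoding of
  one-point compactifications as in \<^const>\<open>Alexandroff_compactification\<close>).\<close>

type_synonym sphere = "complex option"

text \<open>The map \<open>p / q\<close>, meant for coprime \<open>p\<close> and \<open>q\<close>. The value at infinity is that of the
  homogenisations of \<open>p\<close> and \<open>q\<close> of common degree \<open>n = max (degree p) (degree q)\<close>
  at the point \<open>[1 : 0]\<close>.\<close>

fun ratio_map :: "complex poly \<Rightarrow> complex poly \<Rightarrow> sphere \<Rightarrow> sphere" where
  "ratio_map p q (Some z) =
     (if poly q z = 0 then None else Some (poly p z / poly q z))"
| "ratio_map p q None =
     (let n = max (degree p) (degree q)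
      in if coeff q n = 0 then None else Some (coeff p n / coeff q n))"

definition rational_map_of_degree :: "nat \<Rightarrow> (sphere \<Rightarrow> sphere) \<Rightarrow> bool" where
  "rational_map_of_degree d h \<longleftrightarrow>
     (\<exists>p q. coprime p q \<and> max (degree p) (degree q) = d \<and> h = ratio_map p q)"

text \<open>\<open>coord a\<close> is a local coordinate centred at \<open>a\<close> (\<open>z - a\<close> at a finite point,
  \<open>1 / z\<close> at infinity), and \<open>param a\<close> is its inverse. Only the values of \<open>coord a\<close> near \<open>a\<close>
  matter; \<open>coord (Some a) None\<close> and \<open>coord None (Some 0)\<close> are arbitrary.\<close>

fun coord :: "sphere \<Rightarrow> sphere \<Rightarrow> complex" where
  "coord (Some a) (Some z) = z - a"
| "coord (Some a) None = 0"
| "coord None (Some z) = 1 / z"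
| "coord None None = 0"

fun param :: "sphere \<Rightarrow> complex \<Rightarrow> sphere" where
  "param (Some a) w = Some (a + w)"
| "param None w = (if w = 0 then None else Some (1 / w))"

text \<open>For non-constant \<open>h\<close> the function below is holomorphic near \<open>0\<close> with an isolated zero
  there, so its \<^const>\<open>zorder\<close> is positive.\<close>

definition local_degree :: "(sphere \<Rightarrow> sphere) \<Rightarrow> sphere \<Rightarrow> nat" where
  "local_degree h a = nat (zorder (\<lambda>w. coord (h a) (h (param a w))) 0)"

text \<open>Fibres of a non-constant rational map are finite, and so is its set of branching points,
  so \<^const>\<open>mset_set\<close> is meaningful in the following.\<close>

definition fibre_partition :: "(sphere \<Rightarrow> sphere) \<Rightarrow> sphere \<Rightarrow> nat multiset" where
  "fibre_partition h x = image_mset (local_degree h) (mset_set (h -` {x}))"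

definition branching_points :: "nat \<Rightarrow> (sphere \<Rightarrow> sphere) \<Rightarrow> sphere set" where
  "branching_points d h = {x. fibre_partition h x \<noteq> replicate_mset d 1}"

definition branching_datum :: "nat \<Rightarrow> (sphere \<Rightarrow> sphere) \<Rightarrow> nat multiset multiset" where
  "branching_datum d h = image_mset (fibre_partition h) (mset_set (branching_points d h))"

end

theory Submission
  imports Defs "HOL-Computational_Algebra.Fundamental_Theorem_Algebra"
begin

text \<open>
  The divisibility hypotheses make \<open>f\<close>, up to a Moebius transformation of the target, an
  \<open>r\<close>-th power of a map of degree \<open>k\<close>. Write \<open>f = p / q\<close>
  with \<open>p\<close> and \<open>q\<close> regarded as binary forms of degree \<open>d\<close>. The fibre over a point \<open>b\<close> of the
  sphere is the zero set of a member of the pencil spanned by \<open>p\<close> and \<open>q\<close>, and the local degrees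
  are the orders of these zeros (\<open>ratio_map_eq_iff\<close>, \<open>local_degree_ratio_map\<close>). If \<open>b\<^sub>1\<close>, \<open>b\<^sub>2\<close>,
  \<open>b\<^sub>3\<close> are the branching points, then all orders of zeros of the forms over \<open>b\<^sub>2\<close> and \<open>b\<^sub>3\<close> are
  multiples of \<open>r\<close>, so these forms are \<open>r\<close>-th powers (\<open>poly_is_power\<close>). Since any three members of
  a pencil are linearly dependent, the form over \<open>b\<^sub>1\<close> can be written \<open>P ^ r - Q ^ r\<close>, where \<open>P\<close>
  and \<open>Q\<close> are forms of degree \<open>k\<close> without a common zero on the sphere.

  This difference factors into the \<open>r\<close> forms \<open>P - \<omega> Q\<close> with \<open>\<omega> ^ r = 1\<close>. Each has a zero on the
  sphere, and no two of them share one, for it would be a common zero of \<open>P\<close> and \<open>Q\<close>. So the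
  fibre over \<open>b\<^sub>1\<close> has at least \<open>r\<close> points. If it has exactly two, then \<open>r = 2\<close>, and each of
  \<open>P - Q\<close> and \<open>P + Q\<close> has a single zero, which must therefore have the full order \<open>k\<close>
  (\<open>diff_of_powers_two_zeros\<close>).
\<close>

section \<open>Binary forms on the sphere\<close>

text \<open>A polynomial \<open>F\<close> of degree at most \<open>n\<close> stands for the binary form
  \<open>\<Sum>i\<le>n. coeff F i * X ^ i * Y ^ (n - i)\<close>, evaluated at \<open>[z : 1]\<close> or at \<open>[1 : 0]\<close>.\<close>

fun form_value :: "nat \<Rightarrow> complex poly \<Rightarrow> sphere \<Rightarrow> complex" where
  "form_value n F (Some z) = poly F z"
| "form_value n F None = coeff F n"

fun form_order :: "nat \<Rightarrow> complex poly \<Rightarrow> sphere \<Rightarrow> nat" where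
  "form_order n F (Some z) = order z F"
| "form_order n F None = n - degree F"

lemma form_value_0 [simp]: "form_value n 0 a = 0"
  by (cases a) auto

lemma form_value_diff: "form_value n (F - G) a = form_value n F a - form_value n G a"
  by (cases a) auto

lemma form_value_smult: "form_value n (smult c F) a = c * form_value n F a"
  by (cases a) auto

lemma form_value_mult:
  assumes "degree F \<le> m" "degree G \<le> n"
  shows "form_value (m + n) (F * G) a = form_value m F a * form_value n G a"
proof (cases a)
  case None
  have "coeff (F * G) (m + n) = coeff F m * coeff G n"
  proof (cases "degree F = m \<and> degree G = n")
    case True
    then show ?thesis using coeff_mult_degree_sum[of F G] by simp
  next
    case False
    then have "degree F < m \<or> degree G < n" using assms by auto
    moreover have "degree (F * G) < m + n"
      using degree_mult_le[of F G] assms False by linarith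
    ultimately show ?thesis by (auto simp: coeff_eq_0)
  qed
  then show ?thesis using None by simp
qed simp

lemma form_value_power:
  assumes "degree F \<le> k"
  shows "form_value (r * k) (F ^ r) a = form_value k F a ^ r"
proof (induction r)
  case 0
  show ?case by (cases a) auto
next
  case (Suc r)
  have "degree (F ^ r) \<le> r * k"
    using order_trans[OF degree_power_le mult_le_mono1[OF assms]] by (metis mult.commute)
  then show ?case
    using form_value_mult[OF assms, of "F ^ r" "r * k" a] Suc by simp
qed

lemma form_order_mult:
  assumes "degree F \<le> m" "degree G \<le> n" "F \<noteq> 0" "G \<noteq> 0"
  shows "form_order (m + n) (F * G) a = form_order m F a + form_order n G a"
  using assms by (cases a) (auto simp: order_mult degree_mult_eq)

lemma form_order_eq_0:
  assumes "degree F \<le> n" "form_value n F a \<noteq> 0"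
  shows "form_order n F a = 0"
proof (cases a)
  case None
  then show ?thesis using assms le_degree[of F n] by auto
next
  case (Some z)
  then show ?thesis using assms by (simp add: order_0I)
qed

lemma finite_form_zeros:
  assumes "F \<noteq> 0"
  shows "finite {a. form_value n F a = 0}"
proof -
  have "{a. form_value n F a = 0} \<subseteq> insert None (Some ` {z. poly F z = 0})"
  proof
    fix a assume "a \<in> {a. form_value n F a = 0}"
    then show "a \<in> insert None (Some ` {z. poly F z = 0})" by (cases a) auto
  qed
  then show ?thesis using poly_roots_finite[OF assms] finite_subset by blast
qed

text \<open>A polynomial without roots is constant, and as a form of positive degree it then vanishes
  at infinity.\<close>

lemma form_has_zero:
  assumes "0 < n" "degree F \<le> n"
  shows "\<exists>a. form_value n F a = 0"
proof (cases "degree F = 0")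
  case True
  then have "form_value n F None = 0" using assms by (simp add: coeff_eq_0)
  then show ?thesis by blast
next
  case False
  then obtain z where "poly F z = 0"
    using Fundamental_Theorem_Algebra.fundamental_theorem_of_algebra[of F] by (auto simp: constant_degree)
  then have "form_value n F (Some z) = 0" by simp
  then show ?thesis by blast
qed

lemma form_order_unique_zero:
  assumes deg: "degree F \<le> n" and zeros: "{a. form_value n F a = 0} = {a}"
  shows "F \<noteq> 0" and "form_order n F a = n"
proof -
  have zero_iff: "form_value n F b = 0 \<longleftrightarrow> b = a" for b using zeros by blast
  show "F \<noteq> 0"
  proof
    assume "F = 0"
    then have "Some 0 = a" "Some 1 = a" using zero_iff by (metis form_value_0)+
    then show False by auto
  qed
  show "form_order n F a = n"
  proof (cases a)
    case None
    then have "poly F z \<noteq> 0" for z using zero_iff[of "Some z"] by auto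
    then have "degree F = 0"
      using Fundamental_Theorem_Algebra.fundamental_theorem_of_algebra[of F] by (auto simp: constant_degree)
    then show ?thesis using None by simp
  next
    case (Some z)
    have "coeff F n \<noteq> 0" using zero_iff[of None] Some by auto
    then have "degree F = n" using deg le_degree[of F n] by auto
    have "{w. poly F w = 0} = {z}" using zero_iff[of "Some _"] Some by auto
    then have "smult (lead_coeff F) ([:- z, 1:] ^ order z F) = F"
      using complex_poly_decompose[of F] by simp
    then have "degree F = degree (smult (lead_coeff F) ([:- z, 1:] ^ order z F))" by simp
    also have "\<dots> = order z F" using \<open>F \<noteq> 0\<close> by (simp add: degree_linear_power)
    finally show ?thesis using Some \<open>degree F = n\<close> by simp
  qed
qed

section \<open>Powers of polynomials\<close>

lemma complex_has_root:
  fixes c :: complex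
  assumes "0 < r"
  obtains s where "s ^ r = c"
proof (cases "c = 0")
  case True
  then show ?thesis using that[of 0] assms by simp
next
  case False
  have "exp (Ln c / of_nat r) ^ r = exp (of_nat r * (Ln c / of_nat r))"
    by (simp only: exp_of_nat_mult)
  also have "\<dots> = c" using False assms by simp
  finally show ?thesis by (rule that)
qed

lemma poly_is_power:
  fixes F :: "complex poly"
  assumes "0 < r" and dvd: "\<And>z. poly F z = 0 \<Longrightarrow> r dvd order z F"
  obtains P where "F = P ^ r"
proof -
  obtain s where s: "s ^ r = lead_coeff F" using complex_has_root[OF assms(1)] by blast
  define M where "M = (\<Prod>z | poly F z = 0. [:- z, 1:] ^ (order z F div r))"
  have "M ^ r = (\<Prod>z | poly F z = 0. [:- z, 1:] ^ order z F)"
    unfolding M_def prod_power_distrib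
    by (intro prod.cong) (use dvd in \<open>auto simp flip: power_mult\<close>)
  then have "smult s M ^ r = F"
    using complex_poly_decompose[of F] s by (simp add: smult_power)
  then show ?thesis by (rule that[OF sym])
qed

text \<open>The zeros of \<open>P - \<omega> Q\<close> for the \<open>r\<close> roots of unity \<open>\<omega>\<close> are pairwise different, which bounds
  the number of zeros of \<open>P ^ r - Q ^ r\<close> from below. In the extremal case \<open>r = 2\<close> every zero has
  to carry all of the degree \<open>k\<close> of its factor.\<close>

lemma diff_of_powers_two_zeros:
  fixes P Q :: "complex poly"
  assumes "2 \<le> r" "0 < k" and degP: "degree P \<le> k" and degQ: "degree Q \<le> k"
    and no_common: "\<And>a. form_value k P a \<noteq> 0 \<or> form_value k Q a \<noteq> 0"
    and two: "card {a. form_value (r * k) (P ^ r - Q ^ r) a = 0} = 2"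
  shows "r = 2"
    and "form_value (r * k) (P ^ r - Q ^ r) a = 0 \<Longrightarrow> form_order (r * k) (P ^ r - Q ^ r) a = k"
proof -
  define G where "G \<omega> = P - smult \<omega> Q" for \<omega>
  define Z where "Z = {a. form_value (r * k) (P ^ r - Q ^ r) a = 0}"
  have finZ: "finite Z" and cardZ: "card Z = 2"
    using two card.infinite unfolding Z_def by fastforce+
  have degG: "degree (G \<omega>) \<le> k" for \<omega>
    unfolding G_def using degP degQ degree_smult_le[of \<omega> Q] by (intro degree_diff_le) auto
  have value_G: "form_value k (G \<omega>) a = form_value k P a - \<omega> * form_value k Q a" for \<omega> a
    by (simp add: G_def form_value_diff form_value_smult)
  have G_disjoint: "form_value k (G \<omega>') a \<noteq> 0"
    if "form_value k (G \<omega>) a = 0" "\<omega> \<noteq> \<omega>'" for \<omega> \<omega>' a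
    using that no_common[of a] by (auto simp: value_G)
  have G_zero_in_Z: "a \<in> Z" if "\<omega> ^ r = 1" "form_value k (G \<omega>) a = 0" for \<omega> a
    using that by (simp add: Z_def value_G form_value_diff form_value_power[OF degP]
        form_value_power[OF degQ] power_mult_distrib)
  have "\<exists>a. form_value k (G \<omega>) a = 0" for \<omega>
    using form_has_zero[OF \<open>0 < k\<close> degG] .
  then obtain zero where zero: "form_value k (G \<omega>) (zero \<omega>) = 0" for \<omega> by metis
  have "inj_on zero {\<omega>. \<omega> ^ r = 1}"
  proof (rule inj_onI, rule ccontr)
    fix \<omega> \<omega>' assume "zero \<omega> = zero \<omega>'" "\<omega> \<noteq> \<omega>'"
    then show False using G_disjoint[OF zero[of \<omega>]] zero[of \<omega>'] by simp
  qed
  moreover have "zero ` {\<omega>. \<omega> ^ r = 1} \<subseteq> Z" using G_zero_in_Z zero by auto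
  ultimately have "card {\<omega>::complex. \<omega> ^ r = 1} \<le> card Z" using finZ by (rule card_inj_on_le)
  then show r: "r = 2"
    using cardZ \<open>2 \<le> r\<close> card_roots_unity_eq[of r] by simp

  have rk: "r * k = k + k" by (simp add: r)
  have factor: "P ^ r - Q ^ r = G 1 * G (- 1)"
    by (simp add: r G_def power2_eq_square algebra_simps)
  have Z_split: "Z = {a. form_value k (G 1) a = 0} \<union> {a. form_value k (G (- 1)) a = 0}"
    by (auto simp: Z_def factor rk form_value_mult[OF degG degG])
  have single: "{a. form_value k (G \<omega>) a = 0} = {a}"
    if a: "form_value k (G \<omega>) a = 0" and \<omega>: "\<omega> = 1 \<or> \<omega> = - 1" for \<omega> a
  proof (rule ccontr)
    assume "{a. form_value k (G \<omega>) a = 0} \<noteq> {a}"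
    then obtain b where b: "form_value k (G \<omega>) b = 0" "b \<noteq> a" using a by blast
    \<comment> \<open>A second zero of one factor, together with a zero of the other, gives three zeros.\<close>
    define c where "c = zero (- \<omega>)"
    have "\<omega> \<noteq> - \<omega>" using \<omega> by auto
    then have "c \<noteq> a" "c \<noteq> b"
      using G_disjoint[of \<omega> _ "- \<omega>"] a b(1) zero[of "- \<omega>"] unfolding c_def by auto
    moreover have "{a, b, c} \<subseteq> Z"
      using a \<omega> b zero[of "- \<omega>"] unfolding Z_split c_def by auto
    then have "card {a, b, c} \<le> 2" using card_mono[OF finZ] cardZ by metis
    ultimately show False using b(2) by simp
  qed
  have nz: "G \<omega> \<noteq> 0" if "\<omega> = 1 \<or> \<omega> = - 1" for \<omega>
    using form_order_unique_zero(1)[OF degG single[OF zero that]] .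
  show "form_order (r * k) (P ^ r - Q ^ r) a = k"
    if "form_value (r * k) (P ^ r - Q ^ r) a = 0"
  proof -
    have "a \<in> Z" using that by (simp add: Z_def)
    then obtain \<omega> where \<omega>: "\<omega> = 1 \<or> \<omega> = - 1" "form_value k (G \<omega>) a = 0"
      unfolding Z_split by blast
    then have "\<omega> \<noteq> - \<omega>" by auto
    have "form_order (r * k) (P ^ r - Q ^ r) a = form_order (k + k) (G \<omega> * G (- \<omega>)) a"
      using \<omega>(1) unfolding factor rk by (auto simp: mult.commute)
    also have "\<dots> = form_order k (G \<omega>) a + form_order k (G (- \<omega>)) a"
      using \<omega>(1) nz by (intro form_order_mult degG) auto
    also have "form_order k (G \<omega>) a = k"
      using form_order_unique_zero(2)[OF degG single[OF \<omega>(2,1)]] .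
    also have "form_order k (G (- \<omega>)) a = 0"
      using form_order_eq_0[OF degG G_disjoint[OF \<omega>(2) \<open>\<omega> \<noteq> - \<omega>\<close>]] .
    finally show ?thesis by simp
  qed
qed

section \<open>Fibres of rational maps\<close>

text \<open>The member of the pencil spanned by \<open>p\<close> and \<open>q\<close> that cuts out the fibre of \<open>p / q\<close> over a
  point.\<close>

fun fibre_form :: "complex poly \<Rightarrow> complex poly \<Rightarrow> sphere \<Rightarrow> complex poly" where
  "fibre_form p q (Some c) = p - smult c q"
| "fibre_form p q None = q"

lemma degree_fibre_form: "degree (fibre_form p q b) \<le> max (degree p) (degree q)"
proof (cases b)
  case (Some c)
  then show ?thesis using degree_smult_le[of c q]
    by (auto intro!: degree_diff_le simp: le_max_iff_disj)
qed simp

lemma fibre_forms_linearly_dependent: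
  assumes "b\<^sub>1 \<noteq> b\<^sub>2" "b\<^sub>1 \<noteq> b\<^sub>3" "b\<^sub>2 \<noteq> b\<^sub>3"
  obtains u v where "u \<noteq> 0" "v \<noteq> 0"
    "fibre_form p q b\<^sub>1 = smult u (fibre_form p q b\<^sub>2) + smult v (fibre_form p q b\<^sub>3)"
proof (cases b\<^sub>1)
  case None
  then obtain c\<^sub>2 c\<^sub>3 where c: "b\<^sub>2 = Some c\<^sub>2" "b\<^sub>3 = Some c\<^sub>3" "c\<^sub>2 \<noteq> c\<^sub>3"
    using assms by (cases b\<^sub>2; cases b\<^sub>3) auto
  show ?thesis
    by (rule that[of "1 / (c\<^sub>3 - c\<^sub>2)" "1 / (c\<^sub>2 - c\<^sub>3)"])
      (use None c in \<open>auto simp: poly_eq_iff divide_simps, auto simp: algebra_simps\<close>)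
next
  case b\<^sub>1: (Some c\<^sub>1)
  show ?thesis
  proof (cases b\<^sub>2)
    case None
    then obtain c\<^sub>3 where c: "b\<^sub>3 = Some c\<^sub>3" "c\<^sub>1 \<noteq> c\<^sub>3"
      using assms b\<^sub>1 by (cases b\<^sub>3) auto
    show ?thesis
      by (rule that[of "c\<^sub>3 - c\<^sub>1" 1]) (use b\<^sub>1 None c in \<open>auto simp: poly_eq_iff algebra_simps\<close>)
  next
    case b\<^sub>2: (Some c\<^sub>2)
    show ?thesis
    proof (cases b\<^sub>3)
      case None
      show ?thesis
        by (rule that[of 1 "c\<^sub>2 - c\<^sub>1"])
          (use b\<^sub>1 b\<^sub>2 None assms in \<open>auto simp: poly_eq_iff algebra_simps\<close>)
    next
      case b\<^sub>3: (Some c\<^sub>3)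
      show ?thesis
        by (rule that[of "(c\<^sub>1 - c\<^sub>3) / (c\<^sub>2 - c\<^sub>3)" "(c\<^sub>2 - c\<^sub>1) / (c\<^sub>2 - c\<^sub>3)"])
          (use b\<^sub>1 b\<^sub>2 b\<^sub>3 assms in \<open>auto simp: poly_eq_iff divide_simps, auto simp: algebra_simps\<close>)
    qed
  qed
qed

lemma coprime_no_common_form_zero:
  assumes "coprime p q" and n: "n = max (degree p) (degree q)" "0 < n"
  shows "form_value n p a \<noteq> 0 \<or> form_value n q a \<noteq> 0"
proof (cases a)
  case None
  have "p \<noteq> 0 \<or> q \<noteq> 0" using n by auto
  then show ?thesis using None n
    by (metis form_value.simps(2) leading_coeff_0_iff max_def degree_0 less_irrefl)
next
  case (Some z)
  then show ?thesis using assms coprime_poly_0[of p q z] by auto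
qed

lemma ratio_map_eq_iff:
  assumes "coprime p q" and n: "n = max (degree p) (degree q)" "0 < n"
  shows "ratio_map p q a = b \<longleftrightarrow> form_value n (fibre_form p q b) a = 0"
proof -
  have "form_value n p a \<noteq> 0 \<or> form_value n q a \<noteq> 0"
    using coprime_no_common_form_zero[OF assms] .
  then show ?thesis
    using n by (cases a; cases b) (auto simp: Let_def field_simps)
qed

lemma fibre_form_nonzero:
  assumes "coprime p q" "0 < max (degree p) (degree q)"
  shows "fibre_form p q b \<noteq> 0"
proof
  assume "fibre_form p q b = 0"
  then have const: "ratio_map p q a = b" for a
    using ratio_map_eq_iff[OF assms(1) refl assms(2)] by simp
  obtain b' where "b' \<noteq> b" by (metis option.distinct(1))
  moreover obtain a where "ratio_map p q a = b'"
    using form_has_zero[OF assms(2) degree_fibre_form] ratio_map_eq_iff[OF assms(1) refl assms(2)]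
    by blast
  ultimately show False using const by simp
qed

lemma zorder_poly_quotient:
  assumes "F \<noteq> 0" "poly G z \<noteq> 0"
  shows "zorder (\<lambda>w. poly F (z + w) / poly G (z + w)) 0 = int (order z F)"
proof -
  obtain M where M: "F = [:- z, 1:] ^ order z F * M" "\<not> [:- z, 1:] dvd M"
    using order_decomp[OF assms(1)] by blast
  have "poly M z \<noteq> 0" using M(2) by (simp add: poly_eq_0_iff_dvd)
  let ?S = "{w. poly G (z + w) \<noteq> 0}"
  show ?thesis
  proof (rule zorder_eqI[where S = ?S and g = "\<lambda>w. poly M (z + w) / poly G (z + w)"])
    show "open ?S" by (intro open_Collect_neq continuous_intros)
    show "(\<lambda>w. poly M (z + w) / poly G (z + w)) holomorphic_on ?S"
      by (intro holomorphic_intros) auto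
    fix w :: complex assume "w \<in> ?S"
    have "poly F (z + w) = w ^ order z F * poly M (z + w)"
      by (subst M(1)) simp
    then show "poly F (z + w) / poly G (z + w)
        = poly M (z + w) / poly G (z + w) * (w - 0) powi int (order z F)"
      by simp
  qed (use assms \<open>poly M z \<noteq> 0\<close> in auto)
qed

lemma zorder_poly_quotient_at_infinity:
  assumes "F \<noteq> 0" "G \<noteq> 0" "degree F \<le> degree G"
  shows "zorder (\<lambda>w. poly F (1 / w) / poly G (1 / w)) 0 = int (degree G - degree F)"
proof -
  let ?F = "reflect_poly F" and ?G = "reflect_poly G"
  let ?S = "{w. poly ?G w \<noteq> 0}"
  show ?thesis
  proof (rule zorder_eqI[where S = ?S and g = "\<lambda>w. poly ?F w / poly ?G w"])
    show "open ?S" by (intro open_Collect_neq continuous_intros)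
    show "(\<lambda>w. poly ?F w / poly ?G w) holomorphic_on ?S"
      by (intro holomorphic_intros) auto
    fix w :: complex assume w: "w \<in> ?S" "w \<noteq> 0"
    have "w ^ degree G = w ^ (degree G - degree F) * w ^ degree F"
      using assms by (simp flip: power_add)
    then show "poly F (1 / w) / poly G (1 / w)
        = poly ?F w / poly ?G w * (w - 0) powi int (degree G - degree F)"
      using w by (simp add: poly_reflect_poly_nz inverse_eq_divide)
  qed (use assms in auto)
qed

text \<open>In local coordinates \<open>p / q\<close> is, near a point of the fibre over \<open>b\<close>, the form of the fibre
  divided by a form that does not vanish at the point: \<open>q\<close> for finite \<open>b\<close>, \<open>p\<close> for infinite \<open>b\<close>.\<close>

lemma local_degree_ratio_map:
  assumes "coprime p q" and n: "n = max (degree p) (degree q)" "0 < n"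
    and ab: "ratio_map p q a = b"
  shows "local_degree (ratio_map p q) a = form_order n (fibre_form p q b) a"
proof -
  define F where "F = fibre_form p q b"
  define G where "G = (case b of None \<Rightarrow> p | Some _ \<Rightarrow> q)"
  have F0: "F \<noteq> 0" unfolding F_def using fibre_form_nonzero assms by blast
  have degF: "degree F \<le> n" unfolding F_def n by (rule degree_fibre_form)
  have Fa: "form_value n F a = 0"
    using ratio_map_eq_iff[OF assms(1) n] ab by (simp add: F_def)
  have Ga: "form_value n G a \<noteq> 0"
    using coprime_no_common_form_zero[OF assms(1) n, of a] Fa
    by (auto simp: F_def G_def form_value_diff form_value_smult split: option.splits)
  have quotient: "coord b (ratio_map p q (Some z)) = poly F z / poly G z"
    if "poly G z \<noteq> 0" for z
    using that by (cases b) (auto simp: F_def G_def field_simps)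
  have "zorder (\<lambda>w. coord b (ratio_map p q (param a w))) 0 = int (form_order n F a)"
  proof (cases a)
    case (Some z)
    have "isCont (\<lambda>w. poly G (z + w)) 0" by (intro continuous_intros)
    then have "\<forall>\<^sub>F w in at 0. poly G (z + w) \<noteq> 0"
      using Ga Some by (intro tendsto_imp_eventually_ne[where c = "poly G z"]) (auto simp: isCont_def)
    then have "\<forall>\<^sub>F w in at 0. coord b (ratio_map p q (param a w)) = poly F (z + w) / poly G (z + w)"
      unfolding Some param.simps by eventually_elim (rule quotient)
    then have "zorder (\<lambda>w. coord b (ratio_map p q (param a w))) 0
        = zorder (\<lambda>w. poly F (z + w) / poly G (z + w)) 0"
      by (intro zorder_cong) auto
    then show ?thesis using zorder_poly_quotient[OF F0, of G z] Ga Some by simp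
  next
    case None
    have "degree G \<le> n" using n by (auto simp: G_def split: option.splits)
    then have degG: "degree G = n" "G \<noteq> 0" using Ga None le_degree[of G n] by auto
    have "isCont (poly (reflect_poly G)) 0" by (intro continuous_intros)
    then have "\<forall>\<^sub>F w in at 0. poly (reflect_poly G) w \<noteq> 0"
      using degG by (intro tendsto_imp_eventually_ne[where c = "lead_coeff G"]) (auto simp: isCont_def)
    moreover have "\<forall>\<^sub>F w in at (0::complex). w \<noteq> 0" by (simp add: eventually_at_filter)
    ultimately have "\<forall>\<^sub>F w in at 0.
        coord b (ratio_map p q (param a w)) = poly F (1 / w) / poly G (1 / w)"
    proof eventually_elim
      case (elim w)
      then have "poly G (1 / w) \<noteq> 0" by (simp add: poly_reflect_poly_nz inverse_eq_divide)
      then show ?case using elim quotient[of "1 / w"] None by simp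
    qed
    then have "zorder (\<lambda>w. coord b (ratio_map p q (param a w))) 0
        = zorder (\<lambda>w. poly F (1 / w) / poly G (1 / w)) 0"
      by (intro zorder_cong) auto
    then show ?thesis
      using zorder_poly_quotient_at_infinity[OF F0 degG(2)] degF degG None by simp
  qed
  then show ?thesis by (simp add: local_degree_def ab F_def)
qed

section \<open>Branching data with three points\<close>

theorem corollary1p2:
  fixes r k d :: nat
    and f :: "sphere \<Rightarrow> sphere"
    and \<alpha> x y :: "nat multiset"
  assumes "r \<ge> 2" and "k \<ge> 2" and "d = r * k"
    and "rational_map_of_degree d f"
    and "card (branching_points d f) = 3"
    and "branching_datum d f = {# \<alpha>, image_mset (\<lambda>n. r * n) x, image_mset (\<lambda>n. r * n) y #}"
    and "\<forall>n\<in>#\<alpha>. n > 0" and "\<forall>n\<in>#x. n > 0" and "\<forall>n\<in>#y. n > 0"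
    and "size \<alpha> = 2"
  shows "r = 2 \<and> \<alpha> = {# k, k #}"
proof -
  obtain p q where pq: "coprime p q" "d = max (degree p) (degree q)" "f = ratio_map p q"
    using assms(4) unfolding rational_map_of_degree_def by blast
  have r0: "0 < r" and k0: "0 < k" and d0: "0 < d" using assms(1-3) by auto
  let ?F = "fibre_form p q"
  have fibre: "f -` {b} = {a. form_value d (?F b) a = 0}" for b
    using ratio_map_eq_iff[OF pq(1,2) d0] pq(3) by auto
  have loc: "local_degree f a = form_order d (?F (f a)) a" for a
    using local_degree_ratio_map[OF pq(1,2) d0] pq(3) by simp
  have F0: "?F b \<noteq> 0" for b using fibre_form_nonzero pq(1,2) d0 by blast
  have fin: "finite (f -` {b})" for b
    unfolding fibre by (rule finite_form_zeros[OF F0])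

  obtain b\<^sub>1 b\<^sub>2 b\<^sub>3 where b: "mset_set (branching_points d f) = {# b\<^sub>1, b\<^sub>2, b\<^sub>3 #}"
      "fibre_partition f b\<^sub>1 = \<alpha>" "fibre_partition f b\<^sub>2 = image_mset (\<lambda>n. r * n) x"
      "fibre_partition f b\<^sub>3 = image_mset (\<lambda>n. r * n) y"
    using assms(6) unfolding branching_datum_def
    by (auto dest!: msed_map_invR)
  have ne: "b\<^sub>1 \<noteq> b\<^sub>2" "b\<^sub>1 \<noteq> b\<^sub>3" "b\<^sub>2 \<noteq> b\<^sub>3"
  proof -
    have "count {# b\<^sub>1, b\<^sub>2, b\<^sub>3 #} c \<le> 1" for c
      unfolding b(1)[symmetric] count_mset_set' by simp
    from this[of b\<^sub>1] this[of b\<^sub>2] show "b\<^sub>1 \<noteq> b\<^sub>2" "b\<^sub>1 \<noteq> b\<^sub>3" "b\<^sub>2 \<noteq> b\<^sub>3"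
      by (auto split: if_splits)
  qed

  \<comment> \<open>The scalar \<open>c\<close> is there to absorb the coefficients of a linear relation into the powers.\<close>
  have power: "\<exists>P. smult c (?F b) = P ^ r \<and> degree P \<le> k"
    if part: "fibre_partition f b = image_mset (\<lambda>n. r * n) m" for b c and m :: "nat multiset"
  proof -
    have "r dvd order z (?F b)" if "poly (?F b) z = 0" for z
    proof -
      have "Some z \<in> f -` {b}" using that by (simp add: fibre)
      then have "local_degree f (Some z) \<in># fibre_partition f b" "f (Some z) = b"
        using fin by (auto simp: fibre_partition_def)
      then show ?thesis unfolding part loc by auto
    qed
    then obtain R where R: "?F b = R ^ r" using poly_is_power[OF r0] by blast
    obtain s where s: "s ^ r = c" using complex_has_root[OF r0] by blast
    have "r * degree R \<le> r * k"
      using degree_fibre_form[of p q b] R F0[of b] pq(2) assms(3)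
      by (simp add: degree_power_eq r0)
    then have "degree (smult s R) \<le> k" using r0 degree_smult_le[of s R] by simp
    moreover have "smult c (?F b) = smult s R ^ r" by (simp add: R s smult_power)
    ultimately show ?thesis by blast
  qed

  obtain u v where uv: "u \<noteq> 0" "v \<noteq> 0" "?F b\<^sub>1 = smult u (?F b\<^sub>2) + smult v (?F b\<^sub>3)"
    using fibre_forms_linearly_dependent[OF ne] .
  obtain P where P: "smult u (?F b\<^sub>2) = P ^ r" "degree P \<le> k" using power[OF b(3)] by blast
  obtain Q where Q: "smult (- v) (?F b\<^sub>3) = Q ^ r" "degree Q \<le> k" using power[OF b(4)] by blast
  have F1: "?F b\<^sub>1 = P ^ r - Q ^ r" using uv by (simp flip: P(1) Q(1))
  have no_common: "form_value k P a \<noteq> 0 \<or> form_value k Q a \<noteq> 0" for a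
  proof (rule ccontr)
    assume "\<not> ?thesis"
    then have "form_value d (smult u (?F b\<^sub>2)) a = 0" "form_value d (smult (- v) (?F b\<^sub>3)) a = 0"
      unfolding P(1) Q(1) assms(3)
      using r0 by (simp_all add: form_value_power[OF P(2)] form_value_power[OF Q(2)])
    then have "a \<in> f -` {b\<^sub>2}" "a \<in> f -` {b\<^sub>3}"
      using uv by (simp_all add: fibre form_value_smult del: smult_minus_left)
    then show False using ne by simp
  qed
  have card2: "card (f -` {b\<^sub>1}) = 2"
    using assms(10) by (simp flip: b(2) add: fibre_partition_def)
  have two: "card {a. form_value (r * k) (P ^ r - Q ^ r) a = 0} = 2"
    using card2 by (simp add: fibre F1 assms(3))
  note extremal = diff_of_powers_two_zeros[OF assms(1) k0 P(2) Q(2) no_common two]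
  have "local_degree f a = k" if "a \<in> f -` {b\<^sub>1}" for a
  proof -
    have "f a = b\<^sub>1" using that by simp
    then show ?thesis using that extremal(2)[of a] by (simp add: loc F1 assms(3) fibre)
  qed
  then have "fibre_partition f b\<^sub>1 = image_mset (\<lambda>_. k) (mset_set (f -` {b\<^sub>1}))"
    unfolding fibre_partition_def using fin by (intro image_mset_cong) auto
  also have "\<dots> = {# k, k #}" using card2 by (simp add: image_mset_const_eq numeral_2_eq_2)
  finally show ?thesis using extremal(1) b(2) by simp
qed

end
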